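(* Let $b\ge2$ be an integer. Then, as $n\to\infty$, $$\frac1b\sum_{t\ge1}\sum_{\substack{p_1>\cdots>p_t\ge1\\ p_1+\cdots+p_t=n}}\frac{(b-1)^n}{\binom{t+b-1}{b}}\prod_{i=1}^t\left(\frac{i+b-1}{i+b-2}\right)^{p_i}=(\gamma_b-o(1))\,b^n,$$ where $o(1)$ denotes a quantity tending to $0$ as $n\to\infty$ and $$\gamma_b=\frac1b\sum_{t\ge1}\frac{(t-1)!\,(b-1)^{(t+2)(t-1)/2}}{\prod_{i=2}^t\big((b-1)b^i-(b-1)^i(b+i-1)\big)}$$ (the empty product for $t=1$ equals $1$).
   Context: The inner sum ranges over all partitions of $n$ into $t$ distinct positive parts $p_1>\cdots>p_t\ge1$; it is empty (zero) if there are none. *)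

theory Defs
  imports "HOL-Analysis.Analysis"
begin

text \<open>A partition of \<open>n\<close> into \<open>t\<close> distinct positive parts is represented by the map
  \<open>i \<mapsto> p\<^sub>i\<close> on \<open>{1..t}\<close>, extended by \<^const>\<open>undefined\<close> elsewhere so that every
  partition is counted exactly once.\<close>

definition distinct_partitions :: "nat \<Rightarrow> nat \<Rightarrow> (nat \<Rightarrow> nat) set" where
  "distinct_partitions n t =
     {p \<in> {1..t} \<rightarrow>\<^sub>E {1..}. strict_antimono_on {1..t} p \<and> (\<Sum>i=1..t. p i) = n}"

definition partition_sum :: "nat \<Rightarrow> nat \<Rightarrow> real" where
  "partition_sum b n =
     1 / real b * (\<Sum>\<^sub>\<infinity>t\<in>{1..}. \<Sum>p\<in>distinct_partitions n t.
       (real b - 1) ^ n / real ((t + b - 1) choose b) *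
       (\<Prod>i=1..t. ((real i + real b - 1) / (real i + real b - 2)) ^ p i))"

definition gamma_term :: "nat \<Rightarrow> nat \<Rightarrow> real" where
  "gamma_term b t =
     fact (t - 1) * (real b - 1) ^ ((t + 2) * (t - 1) div 2) /
     (\<Prod>i=2..t. (real b - 1) * real b ^ i - (real b - 1) ^ i * (real b + real i - 1))"

definition gamma_const :: "nat \<Rightarrow> real" where
  "gamma_const b = 1 / real b * (\<Sum>\<^sub>\<infinity>t\<in>{1..}. gamma_term b t)"

end

theory Submission imports Defs begin

text \<open>Put \<open>y\<^sub>i = (i + b - 1) (b - 1)\<^bsup>i-1\<^esup> / b\<^sup>i\<close>, so \<open>y\<^sub>1 = 1\<close> and \<open>0 < y\<^sub>i < 1\<close> for \<open>i \<ge> 2\<close>.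
  Writing a partition in terms of its gaps \<open>q\<^sub>i = p\<^sub>i - p\<^bsub>i+1\<^esub> \<ge> 1\<close>, the product telescopes and,
  after division by \<open>b\<^sup>n\<close>, its weight is the product of the \<open>y\<^sub>i\<close> to the powers \<open>q\<^sub>i\<close>.
  Since \<open>y\<^sub>1 = 1\<close>, the gap \<open>q\<^sub>1\<close> only absorbs the constraint \<open>\<Sum> i q\<^sub>i = n\<close>, and as \<open>n\<close> grows
  the sum over the other gaps fills up to the product of the geometric series
  \<open>y\<^sub>i / (1 - y\<^sub>i)\<close>, \<open>2 \<le> i \<le> t\<close>. These products also bound the sums for finite \<open>n\<close>,
  so the limit may be taken under the sum over \<open>t\<close> by dominated convergence. Fixing \<open>t\<close>, the
  gaps are peeled off one at a time by subtracting the smallest part from all parts.\<close>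

section \<open>Peeling the smallest part off a partition\<close>

lemma finite_distinct_partitions: "finite (distinct_partitions n t)"
proof (rule finite_subset)
  show "distinct_partitions n t \<subseteq> {1..t} \<rightarrow>\<^sub>E {..n}"
  proof
    fix p assume p: "p \<in> distinct_partitions n t"
    have "p i \<le> n" if "i \<in> {1..t}" for i
    proof -
      have "p i \<le> (\<Sum>i=1..t. p i)"
        using that by (intro member_le_sum) auto
      with p show ?thesis
        by (simp add: distinct_partitions_def)
    qed
    with p show "p \<in> {1..t} \<rightarrow>\<^sub>E {..n}"
      by (auto simp: distinct_partitions_def PiE_iff)
  qed
qed (auto intro: finite_PiE)

text \<open>Undoes the peeling, with \<open>k\<close> as the last gap. The explicit 0 stands in for
  \<open>p (Suc t)\<close>, which is \<open>undefined\<close>, and the restriction keeps the result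
  extensional.\<close>

definition append_part :: "nat \<Rightarrow> nat \<Rightarrow> (nat \<Rightarrow> nat) \<Rightarrow> nat \<Rightarrow> nat" where
  "append_part t k p = (\<lambda>i\<in>{1..Suc t}. (if i = Suc t then 0 else p i) + k)"

lemma sum_append_part: "(\<Sum>i=1..Suc t. append_part t k p i) = (\<Sum>i=1..t. p i) + Suc t * k"
proof -
  have "(\<Sum>i=1..t. append_part t k p i) = (\<Sum>i=1..t. p i + k)"
    by (intro sum.cong) (auto simp: append_part_def)
  then show ?thesis
    by (simp add: sum.distrib) (simp add: append_part_def)
qed

lemma append_part_in_distinct_partitions:
  assumes "p \<in> distinct_partitions m t" "k \<ge> 1"
  shows "append_part t k p \<in> distinct_partitions (m + Suc t * k) (Suc t)"
proof -
  have p: "p i \<ge> 1" if "i \<in> {1..t}" for i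
    using assms that by (auto simp: distinct_partitions_def PiE_iff)
  have anti: "p j < p i" if "i \<in> {1..t}" "j \<in> {1..t}" "i < j" for i j
    using assms that by (auto simp: distinct_partitions_def monotone_on_def)
  have "append_part t k p \<in> {1..Suc t} \<rightarrow>\<^sub>E {1..}"
    using assms(2) by (auto simp: append_part_def)
  moreover have "strict_antimono_on {1..Suc t} (append_part t k p)"
  proof (rule monotone_onI)
    fix i j assume ij: "i \<in> {1..Suc t}" "j \<in> {1..Suc t}" "i < j"
    then have "i \<in> {1..t}" by auto
    with ij p[of i] anti[of i j] show "append_part t k p j < append_part t k p i"
      by (auto simp: append_part_def)
  qed
  moreover have "(\<Sum>i=1..Suc t. append_part t k p i) = m + Suc t * k"
    unfolding sum_append_part using assms(1) by (simp add: distinct_partitions_def)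
  ultimately show ?thesis
    unfolding distinct_partitions_def by blast
qed

text \<open>By strict decrease every earlier part exceeds \<open>p (Suc t)\<close>, so the natural
  subtraction never truncates and the reduced parts stay positive and distinct.\<close>

lemma distinct_partitions_drop_last:
  assumes "p \<in> distinct_partitions n (Suc t)"
  defines "q \<equiv> (\<lambda>i\<in>{1..t}. p i - p (Suc t))"
  shows "append_part t (p (Suc t)) q = p" "Suc t * p (Suc t) \<le> n" "1 \<le> p (Suc t)"
    "q \<in> distinct_partitions (n - Suc t * p (Suc t)) t"
proof -
  show 1: "1 \<le> p (Suc t)"
    using assms(1) by (auto simp: distinct_partitions_def PiE_iff)
  have anti: "p j < p i" if "i \<in> {1..Suc t}" "j \<in> {1..Suc t}" "i < j" for i j
    using assms(1) that by (auto simp: distinct_partitions_def monotone_on_def)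
  have last: "p (Suc t) < p i" if "i \<in> {1..t}" for i
    using anti[of i "Suc t"] that by auto
  show 2: "append_part t (p (Suc t)) q = p"
  proof
    fix i
    \<comment> \<open>Equality of functions also concerns arguments outside the index set, where
      both sides are \<open>undefined\<close>.\<close>
    have "p i = undefined" if "i \<notin> {1..Suc t}"
      using assms(1) that by (auto simp: distinct_partitions_def PiE_iff extensional_def)
    with last[of i] show "append_part t (p (Suc t)) q i = p i"
      by (auto simp: append_part_def q_def restrict_def)
  qed
  have "n = (\<Sum>i=1..Suc t. append_part t (p (Suc t)) q i)"
    unfolding 2 using assms(1) by (simp add: distinct_partitions_def)
  then have 3: "n = (\<Sum>i=1..t. q i) + Suc t * p (Suc t)"
    unfolding sum_append_part .
  then show "Suc t * p (Suc t) \<le> n" by simp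
  have "strict_antimono_on {1..t} q"
  proof (rule monotone_onI)
    fix i j assume "i \<in> {1..t}" "j \<in> {1..t}" "i < j"
    with anti[of i j] last[of j] show "q j < q i"
      by (auto simp: q_def)
  qed
  moreover have "q \<in> {1..t} \<rightarrow>\<^sub>E {1..}"
    using last by (fastforce simp: q_def)
  ultimately show "q \<in> distinct_partitions (n - Suc t * p (Suc t)) t"
    unfolding distinct_partitions_def using 3 by simp
qed

text \<open>\<open>append_part\<close> is a bijection from pairs of a smallest part \<open>k\<close>
  and a reduced partition; raising \<open>Suc t\<close> parts by \<open>k\<close> uses up
  \<open>Suc t * k\<close> of \<open>n\<close>.\<close>

lemma sum_distinct_partitions_Suc:
  "(\<Sum>p\<in>distinct_partitions n (Suc t). F p) =
   (\<Sum>k | 1 \<le> k \<and> Suc t * k \<le> n.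
      \<Sum>p\<in>distinct_partitions (n - Suc t * k) t. F (append_part t k p))"
    (is "?L = (\<Sum>k\<in>?K. ?R k)")
proof -
  have "?K \<subseteq> {..n}"
    by auto
  then have fin: "finite ?K"
    using finite_subset by blast
  have "?L = (\<Sum>(k, p)\<in>(SIGMA k:?K. distinct_partitions (n - Suc t * k) t). F (append_part t k p))"
  proof (rule sum.reindex_bij_witness
      [where i = "\<lambda>(k, p). append_part t k p"
        and j = "\<lambda>p. (p (Suc t), \<lambda>i\<in>{1..t}. p i - p (Suc t))"], goal_cases)
    case (1 p)
    then show ?case using distinct_partitions_drop_last(1)[OF 1] by simp
  next
    case (2 p)
    then show ?case using distinct_partitions_drop_last[OF 2] by simp
  next
    case (3 x)
    then obtain k p where x: "x = (k, p)" "p \<in> distinct_partitions (n - Suc t * k) t"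
      by auto
    have "p i = undefined" if "i \<notin> {1..t}" for i
      using x that by (auto simp: distinct_partitions_def PiE_iff extensional_def)
    then show ?case
      unfolding x by (auto simp: append_part_def restrict_def)
  next
    case (4 x)
    then obtain k p where x: "x = (k, p)" "p \<in> distinct_partitions (n - Suc t * k) t"
        "1 \<le> k" "Suc t * k \<le> n"
      by auto
    show ?case
      using append_part_in_distinct_partitions[OF x(2,3)] x by simp
  next
    case (5 p)
    then show ?case using distinct_partitions_drop_last(1)[OF 5] by simp
  qed
  also have "\<dots> = (\<Sum>k\<in>?K. ?R k)"
    using fin by (subst sum.Sigma) (auto simp: finite_distinct_partitions)
  finally show ?thesis .
qed

section \<open>Normalised weights and their recursion in the number of parts\<close>

text \<open>This is \<open>y\<^sub>t\<close>, the factor gained when each of \<open>t\<close> parts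
  grows by one: a power of \<open>(b - 1) / b\<close> from the size, times the telescoped product of
  the ratios.\<close>

definition part_rate :: "nat \<Rightarrow> nat \<Rightarrow> real" where
  "part_rate b t = ((real b - 1) / real b) ^ t * ((real t + real b - 1) / (real b - 1))"

text \<open>The inner sum divided by \<open>b ^ n\<close>. The binomial depends on \<open>t\<close>
  alone and is kept apart so that the recursion stays simple.\<close>

definition partition_weight :: "nat \<Rightarrow> nat \<Rightarrow> nat \<Rightarrow> real" where
  "partition_weight b n t = (\<Sum>p\<in>distinct_partitions n t. ((real b - 1) / real b) ^ n *
     (\<Prod>i=1..t. ((real i + real b - 1) / (real i + real b - 2)) ^ p i))"

lemma prod_part_ratio:
  assumes "b \<ge> 2"
  shows "(\<Prod>i=1..t. (real i + real b - 1) / (real i + real b - 2)) =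
    (real t + real b - 1) / (real b - 1)"
proof (induction t)
  case 0
  then show ?case using assms by simp
next
  case (Suc t)
  have "(\<Prod>i=1..Suc t. (real i + real b - 1) / (real i + real b - 2)) =
      (real t + real b - 1) / (real b - 1) * ((real t + real b) / (real t + real b - 1))"
    by (simp add: Suc.IH[simplified])
  also have "\<dots> = (real (Suc t) + real b - 1) / (real b - 1)"
    using assms by simp
  finally show ?case .
qed

text \<open>A last gap \<open>k\<close> contributes the \<open>k\<close>-th power of every ratio up
  to index \<open>Suc t\<close> and raises the size by \<open>Suc t * k\<close>; together these give
  \<open>part_rate b (Suc t) ^ k\<close>.\<close>

lemma partition_weight_Suc:
  assumes "b \<ge> 2"
  shows "partition_weight b n (Suc t) =
    (\<Sum>k | 1 \<le> k \<and> Suc t * k \<le> n.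
       part_rate b (Suc t) ^ k * partition_weight b (n - Suc t * k) t)"
proof -
  define c where "c = (real b - 1) / real b"
  define x where "x i = (real i + real b - 1) / (real i + real b - 2)" for i
  have "c ^ n * (\<Prod>i=1..Suc t. x i ^ append_part t k p i) =
      part_rate b (Suc t) ^ k * (c ^ (n - Suc t * k) * (\<Prod>i=1..t. x i ^ p i))"
    if "Suc t * k \<le> n" for k p
  proof -
    have "(\<Prod>i=1..t. x i ^ append_part t k p i) = (\<Prod>i=1..t. x i ^ p i * x i ^ k)"
      by (intro prod.cong) (auto simp: append_part_def power_add)
    then have "(\<Prod>i=1..Suc t. x i ^ append_part t k p i) =
        (\<Prod>i=1..t. x i ^ p i) * (\<Prod>i=1..Suc t. x i) ^ k"
      by (simp add: prod.distrib prod_power_distrib power_mult_distrib)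
        (simp add: append_part_def)
    moreover have "c ^ n = (c ^ Suc t) ^ k * c ^ (n - Suc t * k)"
      unfolding power_mult[symmetric] power_add[symmetric] using that by simp
    moreover have "part_rate b (Suc t) = c ^ Suc t * (\<Prod>i=1..Suc t. x i)"
      unfolding x_def prod_part_ratio[OF assms] part_rate_def c_def ..
    ultimately show ?thesis
      by (simp only: power_mult_distrib mult_ac)
  qed
  then show ?thesis
    unfolding partition_weight_def c_def[symmetric] x_def[symmetric] sum_distinct_partitions_Suc
    by (simp add: sum_distrib_left)
qed

lemma distinct_partitions_0: "distinct_partitions n 0 = (if n = 0 then {\<lambda>_. undefined} else {})"
  by (auto simp: distinct_partitions_def monotone_on_def)

lemma part_rate_1: "b \<ge> 2 \<Longrightarrow> part_rate b 1 = 1"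
  by (simp add: part_rate_def)

text \<open>A single part has rate 1, so its weight does not decay with \<open>n\<close>; this is
  the base of the limit argument.\<close>

lemma partition_weight_1:
  assumes "b \<ge> 2"
  shows "partition_weight b n 1 = (if n = 0 then 0 else 1)"
proof -
  have w0: "partition_weight b m 0 = (if m = 0 then 1 else 0)" for m
    by (simp add: partition_weight_def distinct_partitions_0)
  \<comment> \<open>The test \<open>n \<le> k\<close> is the truncated equation
    \<open>n - k = 0\<close>: nothing may remain for zero parts.\<close>
  have "partition_weight b n 1 = (\<Sum>k | 1 \<le> k \<and> k \<le> n. if n \<le> k then 1 else 0)"
    using partition_weight_Suc[OF assms, of n 0] part_rate_1[OF assms] by (simp add: w0)
  also have "\<dots> = (\<Sum>k | 1 \<le> k \<and> k \<le> n. if k = n then 1 else 0)"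
    by (intro sum.cong) auto
  also have "\<dots> = (if n = 0 then 0 else 1)"
    by (subst sum.delta) auto
  finally show ?thesis .
qed

lemma partition_weight_nonneg: "b \<ge> 2 \<Longrightarrow> partition_weight b n t \<ge> 0"
  unfolding partition_weight_def
  by (intro sum_nonneg mult_nonneg_nonneg prod_nonneg zero_le_power divide_nonneg_nonneg ballI) auto

section \<open>Monotonicity and decay of the rates\<close>

lemma part_rate_pos: "b \<ge> 2 \<Longrightarrow> part_rate b t > 0"
  unfolding part_rate_def by (intro mult_pos_pos zero_less_power divide_pos_pos) auto

lemma part_rate_Suc_less:
  assumes "b \<ge> 2" "t \<ge> 1"
  shows "part_rate b (Suc t) < part_rate b t"
proof -
  define c where "c = (real b - 1) / real b"
  have "c > 0"
    using assms by (simp add: c_def)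
  \<comment> \<open>After multiplication by \<open>b\<close> the two sides differ by exactly
    \<open>t\<close>.\<close>
  have "c * (real t + real b) < real t + real b - 1"
    using assms by (simp add: c_def field_simps)
  then have "c ^ t * (c * (real t + real b) / (real b - 1)) <
      c ^ t * ((real t + real b - 1) / (real b - 1))"
    using assms \<open>c > 0\<close> by (intro mult_strict_left_mono divide_strict_right_mono) auto
  then show ?thesis
    by (simp add: part_rate_def c_def[symmetric] mult_ac)
qed

text \<open>The rates decrease strictly from \<open>part_rate b 1 = 1\<close>.\<close>

lemma part_rate_less_1:
  assumes "b \<ge> 2" "t \<ge> 2"
  shows "part_rate b t < 1"
  using assms(2)
proof (induction t rule: dec_induct)
  case base
  then show ?case
    using part_rate_Suc_less[OF assms(1), of 1] part_rate_1[OF assms(1)]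
    by (simp add: numeral_2_eq_2)
next
  case (step t)
  then show ?case
    using part_rate_Suc_less[OF assms(1), of t] by simp
qed

text \<open>Geometric decay beats the linear factor. The limit feeds the ratio test for
  \<open>gamma_term\<close>.\<close>

lemma part_rate_tendsto_0:
  assumes "b \<ge> 2"
  shows "part_rate b \<longlonglongrightarrow> 0"
proof -
  let ?c = "(real b - 1) / real b"
  have c: "norm ?c < 1"
    using assms by (simp add: field_simps)
  have "(\<lambda>t. real t * ?c ^ t / (real b - 1) + ?c ^ t) \<longlonglongrightarrow> 0 / (real b - 1) + 0"
    by (intro tendsto_add tendsto_divide tendsto_const powser_times_n_limit_0[OF c] LIMSEQ_power_zero[OF c])
      (use assms in auto)
  moreover have "part_rate b = (\<lambda>t. real t * ?c ^ t / (real b - 1) + ?c ^ t)"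
    using assms by (auto simp: part_rate_def field_simps)
  ultimately show ?thesis
    by simp
qed

section \<open>Limits of the weights for a fixed number of parts\<close>

definition limit_weight :: "nat \<Rightarrow> nat \<Rightarrow> real" where
  "limit_weight b t = (\<Prod>i=2..t. part_rate b i / (1 - part_rate b i))"

lemma limit_weight_pos: "b \<ge> 2 \<Longrightarrow> limit_weight b t > 0"
  unfolding limit_weight_def
  by (intro prod_pos ballI divide_pos_pos) (auto simp: part_rate_pos part_rate_less_1)

lemma geometric_sums_from_1:
  fixes y :: real
  assumes "norm y < 1"
  shows "(\<lambda>j. y ^ Suc j) sums (y / (1 - y))"
  using sums_mult[OF geometric_sums[OF assms], of y] by simp

text \<open>Padding the finite recursion with zeros gives a series whose index set is independent of
  \<open>n\<close>, as dominated convergence requires; the gap is \<open>Suc j\<close>.\<close>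

lemma partition_weight_Suc_sums:
  assumes "b \<ge> 2"
  shows "(\<lambda>j. if Suc t * Suc j \<le> n
      then part_rate b (Suc t) ^ Suc j * partition_weight b (n - Suc t * Suc j) t else 0)
    sums partition_weight b n (Suc t)"
proof -
  let ?J = "{j. Suc t * Suc j \<le> n}"
  have "?J \<subseteq> {..n}"
    by auto
  then have "finite ?J"
    using finite_subset by blast
  then have "(\<lambda>j. if j \<in> ?J
      then part_rate b (Suc t) ^ Suc j * partition_weight b (n - Suc t * Suc j) t else 0)
    sums (\<Sum>j\<in>?J. part_rate b (Suc t) ^ Suc j * partition_weight b (n - Suc t * Suc j) t)"
    by (rule sums_If_finite_set)
  also have "(\<Sum>j\<in>?J. part_rate b (Suc t) ^ Suc j * partition_weight b (n - Suc t * Suc j) t) =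
      partition_weight b n (Suc t)"
    unfolding partition_weight_Suc[OF assms]
    by (rule sum.reindex_bij_witness[where i = "\<lambda>k. k - 1" and j = Suc])
      (auto simp del: mult_Suc_right power_Suc)
  finally show ?thesis
    by simp
qed

text \<open>Tannery's theorem with a bound valid everywhere. It serves for the sum over one gap and
  for the sum over \<open>t\<close>.\<close>

lemma tendsto_suminf_dominated:
  fixes a :: "nat \<Rightarrow> nat \<Rightarrow> real"
  assumes "\<And>k. a k \<longlonglongrightarrow> l k" "\<And>k n. norm (a k n) \<le> M k" "summable M"
  shows "(\<lambda>n. \<Sum>k. a k n) \<longlonglongrightarrow> suminf l"
  using tannerys_theorem[of a l sequentially M] assms
    always_eventually[of "\<lambda>(k, n). norm (a k n) \<le> M k" "sequentially \<times>\<^sub>F sequentially"]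
  by (auto simp: case_prod_beta)

text \<open>Bound and limit go through one induction, since the bound for \<open>t\<close> supplies
  the dominating series in the limit for \<open>Suc t\<close>. It starts at 1: for
  \<open>t = 0\<close> the weights tend to 0, but the empty product is 1.\<close>

lemma partition_weight_bound_and_limit:
  assumes "b \<ge> 2" "t \<ge> 1"
  shows "(\<forall>n. partition_weight b n t \<le> limit_weight b t) \<and>
    (\<lambda>n. partition_weight b n t) \<longlonglongrightarrow> limit_weight b t"
  using assms(2)
proof (induction t rule: dec_induct)
  case base
  have "(\<lambda>n. if n = 0 then 0 else 1 :: real) \<longlonglongrightarrow> 1"
    by (rule tendsto_eventually) (auto intro: eventually_sequentiallyI[of 1])
  then show ?case
    unfolding partition_weight_1[OF assms(1)] by (simp add: limit_weight_def)
next
  case (step t)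
  define y where "y = part_rate b (Suc t)"
  define L where "L = limit_weight b t"
  define a where "a j n = (if Suc t * Suc j \<le> n
      then y ^ Suc j * partition_weight b (n - Suc t * Suc j) t else 0)" for j n
  have y: "y > 0" "y < 1"
    using assms(1) step.hyps by (auto simp: y_def part_rate_pos part_rate_less_1)
  have a_sums: "(\<lambda>j. a j n) sums partition_weight b n (Suc t)" for n
    unfolding a_def y_def by (rule partition_weight_Suc_sums[OF assms(1)])
  have a_nonneg: "a j n \<ge> 0" for j n
    using y by (auto simp: a_def partition_weight_nonneg[OF assms(1)])
  have a_le: "a j n \<le> y ^ Suc j * L" for j n
    unfolding a_def L_def using step.IH y limit_weight_pos[OF assms(1), of t]
    by (auto intro!: mult_left_mono simp del: power_Suc)
  \<comment> \<open>Shifting \<open>n\<close> by \<open>Suc t * Suc j\<close> makes the condition in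
    \<open>a\<close> always true and cancels the subtraction.\<close>
  have a_lim: "(\<lambda>n. a j n) \<longlonglongrightarrow> y ^ Suc j * L" for j
  proof (rule LIMSEQ_offset)
    have "(\<lambda>n. y ^ Suc j * partition_weight b n t) \<longlonglongrightarrow> y ^ Suc j * L"
      unfolding L_def using step.IH by (intro tendsto_mult tendsto_const) auto
    then show "(\<lambda>n. a j (n + Suc t * Suc j)) \<longlonglongrightarrow> y ^ Suc j * L"
      by (simp add: a_def del: power_Suc mult_Suc mult_Suc_right)
  qed
  have M: "(\<lambda>j. y ^ Suc j * L) sums (y / (1 - y) * L)"
    using y by (intro sums_mult2 geometric_sums_from_1) auto
  have Suc_L: "limit_weight b (Suc t) = y / (1 - y) * L"
    using step.hyps by (simp add: limit_weight_def y_def L_def mult.commute)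
  have "partition_weight b n (Suc t) \<le> limit_weight b (Suc t)" for n
    unfolding Suc_L using sums_le[OF a_le a_sums M] .
  moreover have "(\<lambda>n. \<Sum>j. a j n) \<longlonglongrightarrow> (\<Sum>j. y ^ Suc j * L)"
    using a_nonneg a_le by (intro tendsto_suminf_dominated[OF a_lim _ sums_summable[OF M]]) auto
  then have "(\<lambda>n. partition_weight b n (Suc t)) \<longlonglongrightarrow> limit_weight b (Suc t)"
    using sums_unique[OF a_sums] sums_unique[OF M] by (simp add: Suc_L)
  ultimately show ?case
    by blast
qed

section \<open>The closed form of the limits and its summability\<close>

text \<open>Expanding the fraction by \<open>(b - 1) * b ^ t\<close> produces the factors in the
  denominator of \<open>gamma_term\<close>.\<close>

lemma part_rate_odds:
  assumes "b \<ge> 2" "t \<ge> 2"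
  shows "part_rate b t / (1 - part_rate b t) =
    (real b + real t - 1) * (real b - 1) ^ t /
    ((real b - 1) * real b ^ t - (real b - 1) ^ t * (real b + real t - 1))"
proof -
  define u where "u = (real b - 1) ^ t * (real b + real t - 1)"
  define d where "d = (real b - 1) * real b ^ t"
  have "part_rate b t = u / d"
    by (simp add: part_rate_def u_def d_def power_divide ac_simps)
  moreover have d: "d > 0"
    using assms by (simp add: d_def)
  then have "1 - u / d = (d - u) / d"
    by (simp add: diff_divide_distrib)
  ultimately have "part_rate b t / (1 - part_rate b t) = u / (d - u)"
    using d by simp
  then show ?thesis
    by (simp add: u_def d_def mult.commute)
qed

lemma gamma_term_Suc_Suc:
  assumes "b \<ge> 2"
  shows "gamma_term b (Suc (Suc t)) = gamma_term b (Suc t) *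
    ((real t + 1) * (real b - 1) ^ (t + 2) /
      ((real b - 1) * real b ^ (t + 2) - (real b - 1) ^ (t + 2) * (real b + real (t + 2) - 1)))"
proof -
  let ?d = "\<lambda>i. (real b - 1) * real b ^ i - (real b - 1) ^ i * (real b + real i - 1)"
  \<comment> \<open>The increment is even, so the halved exponent grows by exactly
    \<open>t + 2\<close>.\<close>
  have "(Suc (Suc t) + 2) * (Suc (Suc t) - 1) = (Suc t + 2) * (Suc t - 1) + 2 * (t + 2)"
    by (simp add: algebra_simps)
  then have "(Suc (Suc t) + 2) * (Suc (Suc t) - 1) div 2 = (Suc t + 2) * (Suc t - 1) div 2 + (t + 2)"
    by simp
  moreover have "(\<Prod>i=2..Suc (Suc t). ?d i) = (\<Prod>i=2..Suc t. ?d i) * ?d (t + 2)"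
    by simp
  moreover have "fact (Suc (Suc t) - 1) = fact (Suc t - 1) * (real t + 1)"
    by (simp add: mult.commute add.commute)
  ultimately show ?thesis
    unfolding gamma_term_def by (simp only: power_add times_divide_times_eq mult_ac)
qed

text \<open>Both sides agree at \<open>t = 0\<close> and have equal successive quotients: the factor
  \<open>t + 1 + b\<close> from \<open>part_rate_odds\<close> becomes \<open>t + 1\<close> through
  the quotient of the binomials.\<close>

lemma gamma_term_conv_limit_weight:
  assumes "b \<ge> 2"
  shows "gamma_term b (Suc t) = limit_weight b (Suc t) / real ((t + b) choose b)"
proof (induction t)
  case 0
  then show ?case
    by (simp add: gamma_term_def limit_weight_def)
next
  case (Suc t)
  let ?C = "real ((t + b) choose b)" and ?C' = "real ((Suc t + b) choose b)"
  define p where "p = (real b - 1) ^ (t + 2)"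
  define d where "d = (real b - 1) * real b ^ (t + 2) - p * (real b + real (t + 2) - 1)"
  have "(Suc t + b - b) * ((Suc t + b) choose b) = (Suc t + b) * ((Suc t + b - 1) choose b)"
    by (rule binomial_absorb_comp)
  then have "Suc t * ((Suc t + b) choose b) = (Suc t + b) * ((t + b) choose b)"
    by simp
  then have "real (Suc t * ((Suc t + b) choose b)) = real ((Suc t + b) * ((t + b) choose b))"
    by (rule arg_cong)
  then have C: "(real t + 1) * ?C' = (real t + 1 + real b) * ?C"
    by (simp only: of_nat_mult of_nat_add of_nat_Suc) (simp add: add_ac)
  have pos: "?C > 0" "?C' > 0"
    by simp_all
  from C pos have C': "(real t + 1) / ?C = (real t + 1 + real b) / ?C'"
    by (simp add: field_simps)
  have L: "limit_weight b (Suc (Suc t)) =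
      limit_weight b (Suc t) * ((real t + 1 + real b) * p / d)"
    using part_rate_odds[OF assms, of "t + 2"]
    by (simp add: limit_weight_def p_def d_def add_ac)
  have "gamma_term b (Suc (Suc t)) = limit_weight b (Suc t) * ((real t + 1) / ?C) * (p / d)"
    unfolding gamma_term_Suc_Suc[OF assms] Suc.IH p_def d_def by simp
  also have "\<dots> = limit_weight b (Suc (Suc t)) / ?C'"
    unfolding C' L by (simp add: mult_ac)
  finally show ?case .
qed

lemma gamma_term_pos: "b \<ge> 2 \<Longrightarrow> gamma_term b (Suc t) > 0"
  by (simp add: gamma_term_conv_limit_weight limit_weight_pos)

text \<open>Since the binomials grow with \<open>t\<close>, the ratio of successive terms is at most
  \<open>y / (1 - y)\<close> for a rate \<open>y\<close> tending to 0.\<close>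

lemma summable_gamma_term:
  assumes "b \<ge> 2"
  shows "summable (\<lambda>t. gamma_term b (Suc t))"
proof -
  \<comment> \<open>The threshold 1/3 is where \<open>y / (1 - y)\<close> reaches 1/2.\<close>
  have "eventually (\<lambda>t. part_rate b t < 1 / 3) sequentially"
    using order_tendstoD(2)[OF part_rate_tendsto_0[OF assms], of "1 / 3"] by simp
  then obtain N where N: "part_rate b t < 1 / 3" if "t \<ge> N" for t
    by (auto simp: eventually_sequentially)
  show ?thesis
  proof (rule summable_ratio_test[where c = "1 / 2" and N = N])
    fix t assume t: "t \<ge> N"
    define y where "y = part_rate b (Suc (Suc t))"
    have y: "0 < y" "y < 1 / 3"
      using N[of "Suc (Suc t)"] t part_rate_pos[OF assms] by (auto simp: y_def)
    have "limit_weight b (Suc (Suc t)) = limit_weight b (Suc t) * (y / (1 - y))"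
      by (simp add: limit_weight_def y_def)
    also have "\<dots> \<le> limit_weight b (Suc t) * (1 / 2)"
      using y limit_weight_pos[OF assms, of "Suc t"] by (intro mult_left_mono) (auto simp: field_simps)
    finally have "gamma_term b (Suc (Suc t)) \<le> 1 / 2 * limit_weight b (Suc t) / real ((Suc t + b) choose b)"
      unfolding gamma_term_conv_limit_weight[OF assms] by (intro divide_right_mono) auto
    also have "\<dots> \<le> 1 / 2 * limit_weight b (Suc t) / real ((t + b) choose b)"
      using limit_weight_pos[OF assms, of "Suc t"] binomial_right_mono[of "t + b" "Suc t + b" b]
      by (intro divide_left_mono) auto
    finally have "gamma_term b (Suc (Suc t)) \<le> 1 / 2 * gamma_term b (Suc t)"
      unfolding gamma_term_conv_limit_weight[OF assms] by simp
    then show "norm (gamma_term b (Suc (Suc t))) \<le> 1 / 2 * norm (gamma_term b (Suc t))"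
      using gamma_term_pos[OF assms] by (simp add: less_imp_le)
  qed simp
qed

section \<open>Summation over the number of parts\<close>

lemma has_sum_atLeast_1_iff: "(f has_sum S) {1..} \<longleftrightarrow> ((\<lambda>t. f (Suc t)) has_sum S) UNIV"
proof -
  have "bij_betw Suc UNIV {1..}"
    by (rule bij_betw_byWitness[where f' = "\<lambda>t. t - 1"]) auto
  then show ?thesis
    using has_sum_reindex_bij_betw by blast
qed

text \<open>Domination by \<open>gamma_term\<close> gives convergence, without which the unordered
  sum would take its default value 0. Shifting \<open>t\<close> by one turns
  \<open>t + b - 1\<close> into \<open>t + b\<close>.\<close>

lemma partition_sum_conv_suminf:
  assumes "b \<ge> 2"
  shows "partition_sum b n =
    1 / real b * (\<Sum>t. partition_weight b n (Suc t) / real ((t + b) choose b)) * real b ^ n"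
proof -
  let ?f = "\<lambda>t. partition_weight b n (Suc t) / real ((t + b) choose b)"
  let ?g = "\<lambda>t. \<Sum>p\<in>distinct_partitions n t.
       (real b - 1) ^ n / real ((t + b - 1) choose b) *
       (\<Prod>i=1..t. ((real i + real b - 1) / (real i + real b - 2)) ^ p i)"
  have f_nonneg: "?f t \<ge> 0" for t
    by (simp add: partition_weight_nonneg[OF assms])
  have f_le: "?f t \<le> gamma_term b (Suc t)" for t
    using partition_weight_bound_and_limit[OF assms, of "Suc t"]
    by (simp add: gamma_term_conv_limit_weight[OF assms] divide_right_mono)
  have "summable ?f"
    by (rule summable_comparison_test'[OF summable_gamma_term[OF assms], of 0])
      (simp add: f_le partition_weight_nonneg[OF assms])
  then have "(?f has_sum suminf ?f) UNIV"
    using f_nonneg by (intro sums_nonneg_imp_has_sum summable_sums)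
  then have "((\<lambda>t. ?f t * real b ^ n) has_sum suminf ?f * real b ^ n) UNIV"
    by (rule has_sum_cmult_left)
  moreover have "?g (Suc t) = ?f t * real b ^ n" for t
  proof -
    have "(real b - 1) ^ n = ((real b - 1) / real b) ^ n * real b ^ n"
      using assms by (simp add: power_divide)
    then show ?thesis
      by (simp add: partition_weight_def sum_divide_distrib sum_distrib_left mult_ac
          del: prod.cl_ivl_Suc power_divide)
  qed
  ultimately have "(?g has_sum suminf ?f * real b ^ n) {1..}"
    unfolding has_sum_atLeast_1_iff by simp
  then have "(\<Sum>\<^sub>\<infinity>t\<in>{1..}. ?g t) = suminf ?f * real b ^ n"
    by (rule infsumI)
  then show ?thesis
    unfolding partition_sum_def by (simp only: mult.assoc)
qed

theorem theorem6p7: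
  fixes b :: nat
  assumes "b \<ge> 2"
  shows "gamma_term b summable_on {1..} \<and>
    (\<exists>\<epsilon> :: nat \<Rightarrow> real. \<epsilon> \<longlonglongrightarrow> 0 \<and>
      (\<forall>n. partition_sum b n = (gamma_const b - \<epsilon> n) * real b ^ n))"
proof (intro conjI exI allI)
  let ?f = "\<lambda>t n. partition_weight b n (Suc t) / real ((t + b) choose b)"
  let ?\<gamma> = "\<lambda>t. gamma_term b (Suc t)"
  \<comment> \<open>Obtained by solving the required identity for the error, so only its limit needs
    an argument.\<close>
  let ?\<epsilon> = "\<lambda>n. gamma_const b - 1 / real b * (\<Sum>t. ?f t n)"
  have "(?\<gamma> has_sum suminf ?\<gamma>) UNIV"
    using summable_gamma_term[OF assms] gamma_term_pos[OF assms]
    by (intro sums_nonneg_imp_has_sum summable_sums) (auto intro: less_imp_le)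
  then have sum: "(gamma_term b has_sum suminf ?\<gamma>) {1..}"
    unfolding has_sum_atLeast_1_iff .
  then show "gamma_term b summable_on {1..}"
    by (rule has_sum_imp_summable)
  have \<gamma>: "gamma_const b = 1 / real b * suminf ?\<gamma>"
    unfolding gamma_const_def using infsumI[OF sum] by simp
  have f_lim: "?f t \<longlonglongrightarrow> ?\<gamma> t" for t
    unfolding gamma_term_conv_limit_weight[OF assms]
    using partition_weight_bound_and_limit[OF assms, of "Suc t"] by (intro tendsto_divide) auto
  \<comment> \<open>The limits themselves dominate, uniformly in \<open>n\<close>.\<close>
  have f_le: "norm (?f t n) \<le> ?\<gamma> t" for t n
    using partition_weight_bound_and_limit[OF assms, of "Suc t"]
    by (simp add: gamma_term_conv_limit_weight[OF assms] divide_right_mono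
        partition_weight_nonneg[OF assms])
  have "(\<lambda>n. \<Sum>t. ?f t n) \<longlonglongrightarrow> suminf ?\<gamma>"
    using tendsto_suminf_dominated[OF f_lim f_le summable_gamma_term[OF assms]] .
  then have "?\<epsilon> \<longlonglongrightarrow> 1 / real b * suminf ?\<gamma> - 1 / real b * suminf ?\<gamma>"
    unfolding \<gamma> by (intro tendsto_diff tendsto_mult tendsto_const)
  then show "?\<epsilon> \<longlonglongrightarrow> 0"
    by simp
  show "partition_sum b n = (gamma_const b - ?\<epsilon> n) * real b ^ n" for n
    using partition_sum_conv_suminf[OF assms] by simp
qed

end
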